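(* Let $x,y_1,\dots,y_n$ be vectors of an inner product space $(H;(\cdot,\cdot))$ over $\mathbb{K}$ and $c_1,\dots,c_n\in\mathbb{K}$. Then $\left|\sum_{i=1}^n c_i(x,y_i)\right|^2$ is bounded above by $\|x\|^2$ times each of the following nine quantities: (1) $\max_{1\le k\le n}|c_k|^2\sum_{i,j=1}^n|(y_i,y_j)|$; (2) $\max_{1\le k\le n}|c_k|\left(\sum_{i=1}^n|c_i|^r\right)^{\frac1r}\left[\sum_{i=1}^n\left(\sum_{j=1}^n|(y_i,y_j)|\right)^s\right]^{\frac1s}$, for all $r>1$, $\frac1r+\frac1s=1$; (3) $\max_{1\le k\le n}|c_k|\sum_{k=1}^n|c_k|\max_{1\le i\le n}\left(\sum_{j=1}^n|(y_i,y_j)|\right)$; (4) $\left(\sum_{k=1}^n|c_k|^p\right)^{\frac1p}\max_{1\le i\le n}|c_i|\sum_{i=1}^n\left(\sum_{j=1}^n|(y_i,y_j)|^q\right)^{\frac1q}$, for all $p>1$, $\frac1p+\frac1q=1$; (5) $\left(\sum_{k=1}^n|c_k|^p\right)^{\frac1p}\left(\sum_{i=1}^n|c_i|^t\right)^{\frac1t}\left[\sum_{i=1}^n\left(\sum_{j=1}^n|(y_i,y_j)|^q\right)^{\frac uq}\right]^{\frac1u}$, for all $p>1$, $\frac1p+\frac1q=1$, $t>1$, $\frac1t+\frac1u=1$; (6) $\left(\sum_{k=1}^n|c_k|^p\right)^{\frac1p}\sum_{i=1}^n|c_i|\max_{1\le i\le n}\left\{\left(\sum_{j=1}^n|(y_i,y_j)|^q\right)^{\frac1q}\right\}$,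 for all $p>1$, $\frac1p+\frac1q=1$; (7) $\sum_{k=1}^n|c_k|\,\max_{1\le i\le n}|c_i|\,\sum_{i=1}^n\left[\max_{1\le j\le n}|(y_i,y_j)|\right]$; (8) $\sum_{k=1}^n|c_k|\left(\sum_{i=1}^n|c_i|^m\right)^{\frac1m}\left(\sum_{i=1}^n\left[\max_{1\le j\le n}|(y_i,y_j)|\right]^l\right)^{\frac1l}$, for all $m>1$, $\frac1m+\frac1l=1$; (9) $\left(\sum_{k=1}^n|c_k|\right)^2\max_{1\le i,j\le n}|(y_i,y_j)|$.
   Context: $(H;(\cdot,\cdot))$ is an inner product space over the real or complex number field $\mathbb{K}$, the inner product being linear in the first argument and conjugate-linear in the second; $\|x\|=(x,x)^{1/2}$; $n\ge 1$ is an integer. In each listed quantity a maximum applies only to the factor immediately following it, and each sum or maximum is a separate factor with its own dummy index. *)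

theory Defs
  imports "HOL-Analysis.Analysis"
begin

text \<open>
  The scalar field is \<open>\<real>\<close> or \<open>\<complex>\<close>. A type class lets one
  statement cover both. Since the norm of a \<^class>\<open>real_normed_field\<close> is multiplicative,
  every instance is isomorphic to one of these two (Gelfand--Mazur), and the last two axioms
  determine the real part and the conjugation, so nothing beyond the two instances below is
  admitted.
\<close>

class real_or_complex = real_normed_field +
  fixes re_part :: "'a \<Rightarrow> real"
    and conjugate :: "'a \<Rightarrow> 'a"
  assumes conjugate_add: "conjugate (a + b) = conjugate a + conjugate b"
    and conjugate_mult: "conjugate (a * b) = conjugate a * conjugate b"
    and conjugate_conjugate: "conjugate (conjugate a) = a"
    and add_conjugate: "a + conjugate a = scaleR (2 * re_part a) 1"
    and mult_conjugate: "a * conjugate a = scaleR ((norm a)\<^sup>2) 1"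

instantiation real :: real_or_complex
begin

definition re_part_real :: "real \<Rightarrow> real" where
  "re_part_real a = a"

definition conjugate_real :: "real \<Rightarrow> real" where
  "conjugate_real a = a"

instance
  by standard (simp_all add: re_part_real_def conjugate_real_def power2_eq_square)

end

instantiation complex :: real_or_complex
begin

definition re_part_complex :: "complex \<Rightarrow> real" where
  "re_part_complex a = Re a"

definition conjugate_complex :: "complex \<Rightarrow> complex" where
  "conjugate_complex a = cnj a"

instance
proof
  fix a b :: complex
  show "conjugate (a + b) = conjugate a + conjugate b"
    by (simp add: conjugate_complex_def)
  show "conjugate (a * b) = conjugate a * conjugate b"
    by (simp add: conjugate_complex_def)
  show "conjugate (conjugate a) = a"
    by (simp add: conjugate_complex_def)
  show "a + conjugate a = scaleR (2 * re_part a) 1"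
    by (simp add: conjugate_complex_def re_part_complex_def complex_eq_iff)
  show "a * conjugate a = scaleR ((norm a)\<^sup>2) 1"
    unfolding conjugate_complex_def complex_norm_square[symmetric] scaleR_conv_of_real by simp
qed

end

text \<open>
  Conjugate-linearity in the second argument follows from linearity in the first and conjugate
  symmetry. By conjugate symmetry \<open>ip x x\<close> is real, so \<open>re_part (ip x x)\<close> is \<open>ip x x\<close> itself,
  regarded as a real number.
\<close>

locale inner_product_space = vector_space scale
  for scale :: "'k::real_or_complex \<Rightarrow> 'v::ab_group_add \<Rightarrow> 'v" +
  fixes ip :: "'v \<Rightarrow> 'v \<Rightarrow> 'k"
  assumes ip_add_left: "ip (x + y) z = ip x z + ip y z"
    and ip_scale_left: "ip (scale a x) y = a * ip x y"
    and ip_commute: "ip y x = conjugate (ip x y)"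
    and ip_self_nonneg: "0 \<le> re_part (ip x x)"
    and ip_self_eq_0: "ip x x = 0 \<Longrightarrow> x = 0"

definition ip_norm :: "('v \<Rightarrow> 'v \<Rightarrow> 'k::real_or_complex) \<Rightarrow> 'v \<Rightarrow> real" where
  "ip_norm ip x = sqrt (re_part (ip x x))"

lemma inner_product_space_real_inner:
  "inner_product_space scaleR (inner :: 'v::real_inner \<Rightarrow> 'v \<Rightarrow> real)"
  by unfold_locales
    (auto simp: scaleR_add_right scaleR_add_left inner_add_left conjugate_real_def
      re_part_real_def intro: inner_commute)

lemma ip_norm_real_inner: "ip_norm inner (x :: 'v::real_inner) = norm x"
  by (simp add: ip_norm_def re_part_real_def norm_eq_sqrt_inner)

lemma inner_product_space_complex:
  "inner_product_space (*) (\<lambda>a b :: complex. a * cnj b)"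
  by unfold_locales
    (auto simp: distrib_left distrib_right mult.assoc mult.commute conjugate_complex_def
      re_part_complex_def)

end

theory Submission
  imports Defs
begin

text \<open>
  The sum \<open>\<Sum> c\<^sub>i (x, y\<^sub>i)\<close> is the single inner product of \<open>x\<close> with
  \<open>w = \<Sum> conjugate c\<^sub>i y\<^sub>i\<close>, so the Cauchy--Schwarz inequality bounds its squared modulus by
  \<open>\<parallel>x\<parallel>\<^sup>2 \<parallel>w\<parallel>\<^sup>2\<close>. Expanding \<open>\<parallel>w\<parallel>\<^sup>2\<close> and taking moduli leaves the quadratic form
  \<open>\<Sum>\<^sub>i \<bar>c\<^sub>i\<bar> \<Sum>\<^sub>j \<bar>c\<^sub>j\<bar> \<bar>(y\<^sub>i, y\<^sub>j)\<bar>\<close> (lemma \<open>norm_sum_ip_square_le\<close>).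

  The nine bounds are now the nine ways of estimating first the inner and then the outer sum by
  Hoelder's inequality, with one of the three dual pairs \<open>(\<ell>\<^sup>\<infinity>, \<ell>\<^sup>1)\<close>, \<open>(\<ell>\<^sup>p, \<ell>\<^sup>q)\<close>,
  \<open>(\<ell>\<^sup>1, \<ell>\<^sup>\<infinity>)\<close> each time: lemmas \<open>sum_mult_le_Max_mult_sum\<close>, \<open>sum_mult_le_powr_mult_powr\<close> and
  \<open>sum_mult_le_sum_mult_Max\<close> are the three estimates, and \<open>double_sum_le_iterated\<close> combines any
  two of them.
\<close>

section \<open>Inner products and the Cauchy--Schwarz inequality\<close>

lemma conjugate_0 [simp]: "conjugate (0::'k::real_or_complex) = 0"
  using conjugate_add[of "0::'k" 0] by simp

text \<open>
  The modulus of a conjugate comes out of \<open>a * conjugate a = \<bar>a\<bar>\<^sup>2\<close>, because the norm is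
  multiplicative.
\<close>

lemma norm_conjugate [simp]: "norm (conjugate a) = norm (a::'k::real_or_complex)"
proof (cases "a = 0")
  case False
  have "norm (a * conjugate a) = norm a * norm a"
    by (simp add: mult_conjugate power2_eq_square)
  with False show ?thesis by (simp add: norm_mult)
qed simp

context inner_product_space
begin

lemma ip_zero_left [simp]: "ip 0 z = 0"
  using ip_add_left[of 0 0 z] by simp

lemma ip_zero_right [simp]: "ip z 0 = 0"
  using ip_commute[of z 0] by simp

lemma ip_minus_left: "ip (- x) z = - ip x z"
  using ip_add_left[of "- x" x z] by (simp add: eq_neg_iff_add_eq_0)

lemma ip_diff_left: "ip (x - y) z = ip x z - ip y z"
  using ip_add_left[of x "- y" z] by (simp add: ip_minus_left)

lemma ip_add_right: "ip z (x + y) = ip z x + ip z y"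
  by (metis conjugate_add ip_add_left ip_commute)

lemma ip_scale_right: "ip x (scale a y) = conjugate a * ip x y"
  by (metis conjugate_mult ip_commute ip_scale_left)

lemma ip_diff_right: "ip z (x - y) = ip z x - ip z y"
  using ip_add_right[of z "x - y" y] by simp

lemma ip_sum_left: "ip (sum f A) z = (\<Sum>i\<in>A. ip (f i) z)"
  by (induction A rule: infinite_finite_induct) (auto simp: ip_add_left)

lemma ip_sum_right: "ip z (sum f A) = (\<Sum>i\<in>A. ip z (f i))"
  by (induction A rule: infinite_finite_induct) (auto simp: ip_add_right)

text \<open>
  By conjugate symmetry \<open>(x, x)\<close> is its own conjugate, so its sum with its conjugate is both
  \<open>2 (x, x)\<close> and twice its real part.
\<close>

lemma ip_self_eq_of_real: "ip x x = of_real (re_part (ip x x))"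
proof -
  have "2 * ip x x = ip x x + conjugate (ip x x)"
    using ip_commute[of x x] by simp
  also have "\<dots> = 2 * of_real (re_part (ip x x))"
    by (simp only: add_conjugate) (simp add: scaleR_conv_of_real)
  finally show ?thesis by simp
qed

lemma ip_norm_square: "(ip_norm ip x)\<^sup>2 = re_part (ip x x)"
  by (simp add: ip_norm_def ip_self_nonneg)

lemma norm_ip_self: "norm (ip x x) = (ip_norm ip x)\<^sup>2"
  by (subst ip_self_eq_of_real) (simp add: ip_norm_square ip_self_nonneg)

text \<open>
  The component of \<open>x\<close> orthogonal to \<open>y\<close>, multiplied by \<open>(y, y)\<close> to avoid the division, has a
  nonnegative square; for \<open>y \<noteq> 0\<close> this square is \<open>(y, y)\<close> times the difference of the two sides.
\<close>

lemma Cauchy_Schwarz_ip: "(norm (ip x y))\<^sup>2 \<le> (ip_norm ip x)\<^sup>2 * (ip_norm ip y)\<^sup>2"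
proof (cases "y = 0")
  case False
  define R X where "R = re_part (ip y y)" and "X = re_part (ip x x)"
  define z where "z = scale (ip y y) x - scale (ip x y) y"
  have R: "ip y y = of_real R" and X: "ip x x = of_real X"
    unfolding R_def X_def by (rule ip_self_eq_of_real)+
  have "R \<noteq> 0"
    using False ip_self_eq_0[of y] R by auto
  with ip_self_nonneg[of y] have "R > 0"
    by (simp add: R_def)
  have conj_R: "conjugate (of_real R) = (of_real R :: 'k)"
    using ip_commute[of y y] R by simp
  have yx: "ip y x = conjugate (ip x y)"
    by (rule ip_commute)
  have mod: "ip x y * conjugate (ip x y) = of_real ((norm (ip x y))\<^sup>2)"
    by (simp only: mult_conjugate scaleR_conv_of_real mult_1_right)
  have "ip z z = of_real R * (of_real R * of_real X - ip x y * conjugate (ip x y))"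
    unfolding z_def ip_diff_left ip_diff_right ip_scale_left ip_scale_right yx R X conj_R
    by (simp add: algebra_simps)
  also have "\<dots> = of_real (R * (R * X - (norm (ip x y))\<^sup>2))"
    by (simp only: mod of_real_mult of_real_diff)
  finally have "re_part (ip z z) = R * (R * X - (norm (ip x y))\<^sup>2)"
    using ip_self_eq_of_real[of z] by (metis of_real_eq_iff)
  with ip_self_nonneg[of z] have "0 \<le> R * (R * X - (norm (ip x y))\<^sup>2)"
    by simp
  with \<open>R > 0\<close> have "(norm (ip x y))\<^sup>2 \<le> R * X"
    by (simp add: zero_le_mult_iff)
  then show ?thesis
    by (simp add: ip_norm_square R_def X_def mult.commute)
qed simp

text \<open>
  Moving the coefficients into the second argument conjugates them, which the moduli do not see.
\<close>

lemma norm_sum_ip_square_le: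
  "(norm (\<Sum>i\<in>I. c i * ip x (y i)))\<^sup>2
     \<le> (ip_norm ip x)\<^sup>2 * (\<Sum>i\<in>I. norm (c i) * (\<Sum>j\<in>I. norm (c j) * norm (ip (y i) (y j))))"
proof -
  define w where "w = (\<Sum>i\<in>I. scale (conjugate (c i)) (y i))"
  have "(\<Sum>i\<in>I. c i * ip x (y i)) = ip x w"
    by (simp add: w_def ip_sum_right ip_scale_right conjugate_conjugate)
  then have "(norm (\<Sum>i\<in>I. c i * ip x (y i)))\<^sup>2 \<le> (ip_norm ip x)\<^sup>2 * norm (ip w w)"
    using Cauchy_Schwarz_ip[of x w] by (simp add: norm_ip_self)
  also have "ip w w = (\<Sum>i\<in>I. conjugate (c i) * (\<Sum>j\<in>I. c j * ip (y i) (y j)))"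
    unfolding w_def ip_sum_left
    by (simp add: ip_sum_right ip_scale_left ip_scale_right conjugate_conjugate
        sum_distrib_left mult_ac)
  also have "norm \<dots> \<le> (\<Sum>i\<in>I. norm (c i) * (\<Sum>j\<in>I. norm (c j) * norm (ip (y i) (y j))))"
    by (intro sum_norm_le) (auto simp: norm_mult intro!: mult_left_mono sum_norm_le)
  finally show ?thesis
    by (simp add: mult_left_mono)
qed

end

section \<open>Hoelder-type estimates for finite sums\<close>

lemma Max_image_nonneg:
  fixes a :: "'i \<Rightarrow> real"
  assumes "finite I" "I \<noteq> {}" "\<And>i. i \<in> I \<Longrightarrow> 0 \<le> a i"
  shows "0 \<le> Max (a ` I)"
  using assms by (auto simp: Max_ge_iff)

lemma sum_mult_le_Max_mult_sum:
  fixes a w :: "'i \<Rightarrow> real"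
  assumes "finite I" "\<And>i. i \<in> I \<Longrightarrow> 0 \<le> w i"
  shows "(\<Sum>i\<in>I. a i * w i) \<le> Max (a ` I) * sum w I"
  unfolding sum_distrib_left using assms by (intro sum_mono mult_right_mono) auto

lemma sum_mult_le_sum_mult_Max:
  fixes a w :: "'i \<Rightarrow> real"
  assumes "finite I" "\<And>i. i \<in> I \<Longrightarrow> 0 \<le> a i"
  shows "(\<Sum>i\<in>I. a i * w i) \<le> sum a I * Max (w ` I)"
  using sum_mult_le_Max_mult_sum[of I a w] assms by (simp add: mult.commute)

text \<open>
  Hoelder's inequality for finite sums. After dividing \<open>a\<close> and \<open>w\<close> by their norms, Young's
  inequality \<open>\<alpha> \<beta> \<le> \<alpha>\<^sup>p / p + \<beta>\<^sup>q / q\<close> holds for each term, and the right-hand sides add up to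
  \<open>1 / p + 1 / q = 1\<close>. A vanishing norm forces all the products to vanish.
\<close>

lemma sum_mult_le_powr_mult_powr:
  fixes a w :: "'i \<Rightarrow> real"
  assumes "finite I" "\<And>i. i \<in> I \<Longrightarrow> 0 \<le> a i" "\<And>i. i \<in> I \<Longrightarrow> 0 \<le> w i"
    and p: "p > 1" and pq: "1 / p + 1 / q = 1"
  shows "(\<Sum>i\<in>I. a i * w i)
           \<le> (\<Sum>i\<in>I. a i powr p) powr (1 / p) * (\<Sum>i\<in>I. w i powr q) powr (1 / q)"
proof -
  have "1 / p < 1" using p by simp
  with pq have "1 / q > 0" by linarith
  with pq p have "1 / q < 1" by (smt (verit) divide_pos_pos)
  with \<open>1 / q > 0\<close> have q: "q > 1" by (simp add: divide_less_eq)
  define S T where "S = (\<Sum>i\<in>I. a i powr p)" and "T = (\<Sum>i\<in>I. w i powr q)"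
  have "S \<ge> 0" "T \<ge> 0" by (auto simp: S_def T_def intro: sum_nonneg)
  show ?thesis
  proof (cases "S = 0 \<or> T = 0")
    case True
    then have "\<forall>i\<in>I. a i * w i = 0"
      using \<open>finite I\<close> by (auto simp: S_def T_def sum_nonneg_eq_0_iff)
    then have "(\<Sum>i\<in>I. a i * w i) = 0"
      by (intro sum.neutral)
    then show ?thesis by simp
  next
    case False
    with \<open>S \<ge> 0\<close> \<open>T \<ge> 0\<close> have pos: "S > 0" "T > 0" by auto
    define A B where "A = S powr (1 / p)" and "B = T powr (1 / q)"
    have AB: "A > 0" "B > 0" "A powr p = S" "B powr q = T"
      using pos p q by (auto simp: A_def B_def powr_powr)
    have "(\<Sum>i\<in>I. (a i / A) * (w i / B))
            \<le> (\<Sum>i\<in>I. (a i / A) powr p / p + (w i / B) powr q / q)"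
      using assms AB p q by (intro sum_mono Youngs_inequality) auto
    also have "\<dots> = (\<Sum>i\<in>I. a i powr p / S / p + w i powr q / T / q)"
      using assms AB by (intro sum.cong) (auto simp: powr_divide)
    also have "\<dots> = S / S / p + T / T / q"
      by (simp only: sum.distrib S_def T_def sum_divide_distrib)
    also have "\<dots> = 1"
      using pos pq by simp
    finally have "(\<Sum>i\<in>I. a i * w i) / (A * B) \<le> 1"
      by (simp add: sum_divide_distrib)
    then show ?thesis
      using AB by (simp add: A_def B_def S_def T_def pos_divide_le_eq)
  qed
qed

text \<open>
  In the applications \<open>A\<close> and \<open>B\<close> are norms of \<open>a\<close>, and the functionals \<open>N\<close> and \<open>M\<close> are the
  respective dual norms. The values of \<open>N\<close> on the rows of \<open>g\<close> become the weights of the outer sum.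
\<close>

lemma double_sum_le_iterated:
  fixes a :: "'i \<Rightarrow> real" and g :: "'i \<Rightarrow> 'i \<Rightarrow> real" and N M :: "('i \<Rightarrow> real) \<Rightarrow> real"
  assumes a: "\<And>i. i \<in> I \<Longrightarrow> 0 \<le> a i" and "0 \<le> A"
    and inner: "\<And>i. i \<in> I \<Longrightarrow> (\<Sum>j\<in>I. a j * g i j) \<le> A * N (g i)"
    and outer: "(\<Sum>i\<in>I. a i * N (g i)) \<le> B * M (\<lambda>i. N (g i))"
  shows "(\<Sum>i\<in>I. a i * (\<Sum>j\<in>I. a j * g i j)) \<le> A * B * M (\<lambda>i. N (g i))"
proof -
  have "(\<Sum>i\<in>I. a i * (\<Sum>j\<in>I. a j * g i j)) \<le> (\<Sum>i\<in>I. a i * (A * N (g i)))"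
    using a inner by (intro sum_mono mult_left_mono) auto
  also have "\<dots> = A * (\<Sum>i\<in>I. a i * N (g i))"
    by (simp add: sum_distrib_left mult_ac)
  also have "\<dots> \<le> A * (B * M (\<lambda>i. N (g i)))"
    using outer \<open>0 \<le> A\<close> by (rule mult_left_mono)
  finally show ?thesis by (simp add: mult.assoc)
qed

section \<open>The nine bounds\<close>

theorem theorem5:
  fixes scale :: "'k::real_or_complex \<Rightarrow> 'v::ab_group_add \<Rightarrow> 'v"
    and ip :: "'v \<Rightarrow> 'v \<Rightarrow> 'k"
    and x :: 'v and y :: "nat \<Rightarrow> 'v" and c :: "nat \<Rightarrow> 'k" and n :: nat
  assumes "inner_product_space scale ip"
    and "n \<ge> 1"
  shows
    "(norm (\<Sum>i=1..n. c i * ip x (y i)))\<^sup>2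
        \<le> (ip_norm ip x)\<^sup>2 *
          ((MAX k\<in>{1..n}. (norm (c k))\<^sup>2) * (\<Sum>i=1..n. \<Sum>j=1..n. norm (ip (y i) (y j))))
    \<and> (\<forall>r s :: real. r > 1 \<and> 1 / r + 1 / s = 1 \<longrightarrow>
      (norm (\<Sum>i=1..n. c i * ip x (y i)))\<^sup>2
        \<le> (ip_norm ip x)\<^sup>2 *
          ((MAX k\<in>{1..n}. norm (c k)) * (\<Sum>i=1..n. norm (c i) powr r) powr (1 / r) *
           (\<Sum>i=1..n. (\<Sum>j=1..n. norm (ip (y i) (y j))) powr s) powr (1 / s)))
    \<and> (norm (\<Sum>i=1..n. c i * ip x (y i)))\<^sup>2
        \<le> (ip_norm ip x)\<^sup>2 *
          ((MAX k\<in>{1..n}. norm (c k)) * (\<Sum>k=1..n. norm (c k)) *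
           (MAX i\<in>{1..n}. \<Sum>j=1..n. norm (ip (y i) (y j))))
    \<and> (\<forall>p q :: real. p > 1 \<and> 1 / p + 1 / q = 1 \<longrightarrow>
      (norm (\<Sum>i=1..n. c i * ip x (y i)))\<^sup>2
        \<le> (ip_norm ip x)\<^sup>2 *
          ((\<Sum>k=1..n. norm (c k) powr p) powr (1 / p) * (MAX i\<in>{1..n}. norm (c i)) *
           (\<Sum>i=1..n. (\<Sum>j=1..n. norm (ip (y i) (y j)) powr q) powr (1 / q))))
    \<and> (\<forall>p q t u :: real. p > 1 \<and> 1 / p + 1 / q = 1 \<and> t > 1 \<and> 1 / t + 1 / u = 1 \<longrightarrow>
      (norm (\<Sum>i=1..n. c i * ip x (y i)))\<^sup>2
        \<le> (ip_norm ip x)\<^sup>2 *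
          ((\<Sum>k=1..n. norm (c k) powr p) powr (1 / p) *
           (\<Sum>i=1..n. norm (c i) powr t) powr (1 / t) *
           (\<Sum>i=1..n. (\<Sum>j=1..n. norm (ip (y i) (y j)) powr q) powr (u / q)) powr (1 / u)))
    \<and> (\<forall>p q :: real. p > 1 \<and> 1 / p + 1 / q = 1 \<longrightarrow>
      (norm (\<Sum>i=1..n. c i * ip x (y i)))\<^sup>2
        \<le> (ip_norm ip x)\<^sup>2 *
          ((\<Sum>k=1..n. norm (c k) powr p) powr (1 / p) * (\<Sum>i=1..n. norm (c i)) *
           (MAX i\<in>{1..n}. (\<Sum>j=1..n. norm (ip (y i) (y j)) powr q) powr (1 / q))))
    \<and> (norm (\<Sum>i=1..n. c i * ip x (y i)))\<^sup>2
        \<le> (ip_norm ip x)\<^sup>2 *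
          ((\<Sum>k=1..n. norm (c k)) * (MAX i\<in>{1..n}. norm (c i)) *
           (\<Sum>i=1..n. MAX j\<in>{1..n}. norm (ip (y i) (y j))))
    \<and> (\<forall>m l :: real. m > 1 \<and> 1 / m + 1 / l = 1 \<longrightarrow>
      (norm (\<Sum>i=1..n. c i * ip x (y i)))\<^sup>2
        \<le> (ip_norm ip x)\<^sup>2 *
          ((\<Sum>k=1..n. norm (c k)) * (\<Sum>i=1..n. norm (c i) powr m) powr (1 / m) *
           (\<Sum>i=1..n. (MAX j\<in>{1..n}. norm (ip (y i) (y j))) powr l) powr (1 / l)))
    \<and> (norm (\<Sum>i=1..n. c i * ip x (y i)))\<^sup>2
        \<le> (ip_norm ip x)\<^sup>2 *
          ((\<Sum>k=1..n. norm (c k))\<^sup>2 *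
           (MAX (i, j)\<in>{1..n} \<times> {1..n}. norm (ip (y i) (y j))))"
proof -
  interpret inner_product_space scale ip by fact
  define I where "I = {1..n}"
  have I: "finite I" "I \<noteq> {}" using assms(2) by (auto simp: I_def)
  define a g where "a = (\<lambda>i. norm (c i))" and "g = (\<lambda>i j. norm (ip (y i) (y j)))"
  have a: "0 \<le> a i" and g: "0 \<le> g i j" for i j by (auto simp: a_def g_def)
  define Q where "Q = (\<Sum>i\<in>I. a i * (\<Sum>j\<in>I. a j * g i j))"
  have bound: "(norm (\<Sum>i\<in>I. c i * ip x (y i)))\<^sup>2 \<le> (ip_norm ip x)\<^sup>2 * K" if "Q \<le> K" for K
    using norm_sum_ip_square_le[of c x y I] mult_left_mono[OF that, of "(ip_norm ip x)\<^sup>2"]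
    by (simp add: Q_def a_def g_def)
  have Max_a: "0 \<le> Max (a ` I)" and Max_g: "0 \<le> Max (g i ` I)" for i
    using I a g by (auto intro: Max_image_nonneg)
  have sum_a: "0 \<le> sum a I"
    by (simp add: a sum_nonneg)
  \<comment> \<open>Each of the three rules fixes the estimate of the inner sum and leaves the outer one, hence
    the functional \<open>M\<close>, open; the nine bounds below instantiate \<open>M\<close>.\<close>
  note inner_max_sum = double_sum_le_iterated[of I a "Max (a ` I)" g "\<lambda>w. sum w I",
      OF a Max_a sum_mult_le_Max_mult_sum[OF I(1) g], folded Q_def]
  note inner_powr_powr = double_sum_le_iterated[of I a "(\<Sum>i\<in>I. a i powr p) powr (1 / p)" g
      "\<lambda>w. (\<Sum>j\<in>I. w j powr q) powr (1 / q)" for p q,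
      OF a powr_ge_zero sum_mult_le_powr_mult_powr[OF I(1) a g], folded Q_def]
  note inner_sum_max = double_sum_le_iterated[of I a "sum a I" g "\<lambda>w. Max (w ` I)",
      OF a sum_a sum_mult_le_sum_mult_Max[OF I(1) a], folded Q_def]
  have sum_g: "0 \<le> sum (g i) I" for i
    by (simp add: g sum_nonneg)

  have "Q \<le> Max (a ` I) * Max (a ` I) * (\<Sum>i\<in>I. \<Sum>j\<in>I. g i j)"
    by (rule inner_max_sum[where M = "\<lambda>w. sum w I"]) (intro sum_mult_le_Max_mult_sum I sum_g)
  \<comment> \<open>Squaring is monotone on the nonnegative reals, so both maxima are attained at the same
    index.\<close>
  moreover have "Max (a ` I) * Max (a ` I) = (MAX k\<in>I. (a k)\<^sup>2)"
  proof -
    obtain k where k: "k \<in> I" "Max (a ` I) = a k"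
      using Max_in[of "a ` I"] I by blast
    have "a i \<le> a k" if "i \<in> I" for i
      using that I by (simp flip: k(2))
    then have "(MAX k\<in>I. (a k)\<^sup>2) = (a k)\<^sup>2"
      using I a k(1) by (intro Max_eqI) (auto intro!: power_mono)
    with k show ?thesis by (simp add: power2_eq_square)
  qed
  ultimately have 1: "Q \<le> (MAX k\<in>I. (a k)\<^sup>2) * (\<Sum>i\<in>I. \<Sum>j\<in>I. g i j)"
    by simp

  have 2: "Q \<le> Max (a ` I) * (\<Sum>i\<in>I. a i powr r) powr (1 / r)
                * (\<Sum>i\<in>I. (\<Sum>j\<in>I. g i j) powr s) powr (1 / s)"
    if "r > 1 \<and> 1 / r + 1 / s = 1" for r s
    using that
    by (intro inner_max_sum[where M = "\<lambda>w. (\<Sum>i\<in>I. w i powr s) powr (1 / s)"]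
        sum_mult_le_powr_mult_powr I a sum_g) auto

  have 3: "Q \<le> Max (a ` I) * sum a I * (MAX i\<in>I. \<Sum>j\<in>I. g i j)"
    by (intro inner_max_sum[where M = "\<lambda>w. Max (w ` I)"] sum_mult_le_sum_mult_Max I a)

  have 4: "Q \<le> (\<Sum>k\<in>I. a k powr p) powr (1 / p) * Max (a ` I)
                * (\<Sum>i\<in>I. (\<Sum>j\<in>I. g i j powr q) powr (1 / q))"
    if "p > 1 \<and> 1 / p + 1 / q = 1" for p q
    using that
    by (intro inner_powr_powr[where M = "\<lambda>w. sum w I"] sum_mult_le_Max_mult_sum I) auto

  have 5: "Q \<le> (\<Sum>k\<in>I. a k powr p) powr (1 / p) * (\<Sum>i\<in>I. a i powr t) powr (1 / t)
                * (\<Sum>i\<in>I. (\<Sum>j\<in>I. g i j powr q) powr (u / q)) powr (1 / u)"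
    if "p > 1 \<and> 1 / p + 1 / q = 1 \<and> t > 1 \<and> 1 / t + 1 / u = 1" for p q t u
  proof -
    have "Q \<le> (\<Sum>k\<in>I. a k powr p) powr (1 / p) * (\<Sum>i\<in>I. a i powr t) powr (1 / t)
                * (\<Sum>i\<in>I. ((\<Sum>j\<in>I. g i j powr q) powr (1 / q)) powr u) powr (1 / u)"
      using that
      by (intro inner_powr_powr[where M = "\<lambda>w. (\<Sum>i\<in>I. w i powr u) powr (1 / u)"]
          sum_mult_le_powr_mult_powr I a) auto
    then show ?thesis by (simp add: powr_powr)
  qed

  have 6: "Q \<le> (\<Sum>k\<in>I. a k powr p) powr (1 / p) * sum a I
                * (MAX i\<in>I. (\<Sum>j\<in>I. g i j powr q) powr (1 / q))"
    if "p > 1 \<and> 1 / p + 1 / q = 1" for p q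
    using that
    by (intro inner_powr_powr[where M = "\<lambda>w. Max (w ` I)"] sum_mult_le_sum_mult_Max I a) auto

  have 7: "Q \<le> sum a I * Max (a ` I) * (\<Sum>i\<in>I. MAX j\<in>I. g i j)"
    by (intro inner_sum_max[where M = "\<lambda>w. sum w I"] sum_mult_le_Max_mult_sum I Max_g)

  have 8: "Q \<le> sum a I * (\<Sum>i\<in>I. a i powr m) powr (1 / m)
                * (\<Sum>i\<in>I. (MAX j\<in>I. g i j) powr l) powr (1 / l)"
    if "m > 1 \<and> 1 / m + 1 / l = 1" for m l
    using that
    by (intro inner_sum_max[where M = "\<lambda>w. (\<Sum>i\<in>I. w i powr l) powr (1 / l)"]
        sum_mult_le_powr_mult_powr I a Max_g) auto

  have "Q \<le> sum a I * sum a I * (MAX i\<in>I. MAX j\<in>I. g i j)"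
    by (intro inner_sum_max[where M = "\<lambda>w. Max (w ` I)"] sum_mult_le_sum_mult_Max I a)
  also have "\<dots> \<le> sum a I * sum a I * (MAX (i, j)\<in>I \<times> I. g i j)"
  proof (rule mult_left_mono)
    have "g i j \<le> (MAX (i, j)\<in>I \<times> I. g i j)" if "i \<in> I" "j \<in> I" for i j
      using that I by (intro Max_ge) auto
    then show "(MAX i\<in>I. MAX j\<in>I. g i j) \<le> (MAX (i, j)\<in>I \<times> I. g i j)"
      using I by simp
  qed (simp add: sum_a)
  finally have 9: "Q \<le> (sum a I)\<^sup>2 * (MAX (i, j)\<in>I \<times> I. g i j)"
    by (simp add: power2_eq_square)

  show ?thesis
    unfolding I_def[symmetric]
    using 1 2 3 4 5 6 7 8 9 unfolding a_def g_def
    by (intro conjI allI impI bound)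
qed

end
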